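(* Let either $p=2$ and $n=2m+1$ with $m\geq 1$, or $p>2$ be a prime and $n\geq 1$ be arbitrary, and let $G=C_{p^n}=\langle\sigma\rangle\leq S_{p^n}$ with $\sigma=(1,\dots,p^n)$. Then the quasi-holomorph $\operatorname{QHol}(G)$ is a group and is a Zappa–Szép extension of $\operatorname{Hol}(G)$, namely $\operatorname{QHol}(G)=\pi(\mathcal{Q}(G))\operatorname{Hol}(G)$ where one may take $\pi(\mathcal{Q}(G))=\langle\beta\rangle$.
   Context: Let $X$ be a finite set, $B=\operatorname{Perm}(X)$; a subgroup of $B$ is regular if it acts transitively with trivial point stabilizers. For a regular subgroup $G\leq B$ put $\operatorname{Hol}(G)=\operatorname{Norm}_B(G)$, $\mathcal{S}(G)=\{N\leq B\mid N\text{ regular},\ N\cong G,\ N\leq\operatorname{Hol}(G)\}$, $\mathcal{R}(G)=\{N\leq B\mid N\text{ regular},\ N\cong G,\ G\leq\operatorname{Norm}_B(N)\}$, and $\mathcal{Q}(G)=\bigcap_{N\in\mathcal{S}(G)\cap\mathcal{R}(G)}\{M\in\mathcal{S}(G)\cap\mathcal{R}(G)\mid N\leq\operatorname{Norm}_B(M)\}$. $\pi(\mathcal{Q}(G))$ denotes a set $\{\beta_1,\dots,\beta_t\}\subseteq B$ of representatives of distinct left cosets of $\operatorname{Hol}(G)$ such that $\mathcal{Q}(G)=\{\beta_iG\beta_i^{-1}\}$ (with $t=|\mathcal{Q}(G)|$); the cosets $\beta_i\operatorname{Hol}(G)$ are determined by $\mathcal{Q}(G)$. The quasi-holomorph is $\operatorname{QHol}(G)=\bigcup_i\beta_i\operatorname{Hol}(G)$.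 It is a Zappa–Szép extension (product) of $\operatorname{Hol}(G)$ if it is a group and some $\pi(\mathcal{Q}(G))$ is a subgroup $P$, so that $\operatorname{QHol}(G)=P\operatorname{Hol}(G)$ with $P\cap\operatorname{Hol}(G)=1$. Here $X=\{1,\dots,p^n\}$, $\sigma$ is the $p^n$-cycle $(1,2,\dots,p^n)$, $m=\lfloor n/2\rfloor$, and $\sigma^{p^{n-m}}=\sigma_1\cdots\sigma_{p^{n-m}}$ where $\sigma_i=(i,\,i+p^{n-m},\dots,i+(p^m-1)p^{n-m})$ for $1\leq i\leq p^{n-m}$. With $t_j=\frac{j(j+1)}{2}$, define $\beta=\prod_{i=1}^{p^{n-m}}\sigma_i^{t_{i-1}}$. *)

theory Defs
  imports "HOL-Algebra.Sym_Groups" "HOL-Algebra.Group_Action" "HOL-Computational_Algebra.Primes"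
begin

text \<open>
  The ambient group \<open>B = Perm(X)\<close> is \<^const>\<open>sym_group\<close> \<open>k\<close>, the group of permutations of
  \<open>X = {1..k}\<close> under composition (right factor applied first).
\<close>

definition regular_subgroup :: "nat \<Rightarrow> (nat \<Rightarrow> nat) set \<Rightarrow> bool" where
  "regular_subgroup k N \<longleftrightarrow>
     subgroup N (sym_group k) \<and>
     (\<forall>x\<in>{1..k}. \<forall>y\<in>{1..k}. \<exists>g\<in>N. g x = y) \<and>
     (\<forall>x\<in>{1..k}. stabilizer (sym_group k\<lparr>carrier := N\<rparr>) (\<lambda>g. g) x = {\<one>\<^bsub>sym_group k\<^esub>})"

definition Hol :: "nat \<Rightarrow> (nat \<Rightarrow> nat) set \<Rightarrow> (nat \<Rightarrow> nat) set" where
  "Hol k G = normalizer (sym_group k) G"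

definition S_set :: "nat \<Rightarrow> (nat \<Rightarrow> nat) set \<Rightarrow> (nat \<Rightarrow> nat) set set" where
  "S_set k G = {N. regular_subgroup k N
                 \<and> sym_group k\<lparr>carrier := N\<rparr> \<cong> sym_group k\<lparr>carrier := G\<rparr>
                 \<and> N \<subseteq> Hol k G}"

definition R_set :: "nat \<Rightarrow> (nat \<Rightarrow> nat) set \<Rightarrow> (nat \<Rightarrow> nat) set set" where
  "R_set k G = {N. regular_subgroup k N
                 \<and> sym_group k\<lparr>carrier := N\<rparr> \<cong> sym_group k\<lparr>carrier := G\<rparr>
                 \<and> G \<subseteq> normalizer (sym_group k) N}"

definition Q_set :: "nat \<Rightarrow> (nat \<Rightarrow> nat) set \<Rightarrow> (nat \<Rightarrow> nat) set set" where
  "Q_set k G = (\<Inter>N \<in> S_set k G \<inter> R_set k G.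
                  {M \<in> S_set k G \<inter> R_set k G. N \<subseteq> normalizer (sym_group k) M})"

text \<open>
  \<open>is_pi_Q k G P\<close>: \<open>P\<close> is an admissible choice of \<open>\<pi>(Q(G))\<close>. It need not be unique,
  hence a predicate.
\<close>

definition is_pi_Q :: "nat \<Rightarrow> (nat \<Rightarrow> nat) set \<Rightarrow> (nat \<Rightarrow> nat) set \<Rightarrow> bool" where
  "is_pi_Q k G P \<longleftrightarrow>
     P \<subseteq> carrier (sym_group k) \<and>
     inj_on (\<lambda>b. b <#\<^bsub>sym_group k\<^esub> Hol k G) P \<and>
     Q_set k G = {b <#\<^bsub>sym_group k\<^esub> G #>\<^bsub>sym_group k\<^esub> inv\<^bsub>sym_group k\<^esub> b | b. b \<in> P}"

text \<open>The union does not depend on the choice of \<open>\<pi>(Q(G))\<close>; see \<open>QHol_eq\<close> below.\<close>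

definition QHol :: "nat \<Rightarrow> (nat \<Rightarrow> nat) set \<Rightarrow> (nat \<Rightarrow> nat) set" where
  "QHol k G = (\<Union>b \<in> (SOME P. is_pi_Q k G P). b <#\<^bsub>sym_group k\<^esub> Hol k G)"

lemma coset_Hol_eqI:
  assumes G: "G \<subseteq> carrier (sym_group k)"
    and b: "b \<in> carrier (sym_group k)" and c: "c \<in> carrier (sym_group k)"
    and eq: "b <#\<^bsub>sym_group k\<^esub> G #>\<^bsub>sym_group k\<^esub> inv\<^bsub>sym_group k\<^esub> b
           = c <#\<^bsub>sym_group k\<^esub> G #>\<^bsub>sym_group k\<^esub> inv\<^bsub>sym_group k\<^esub> c"
  shows "b <#\<^bsub>sym_group k\<^esub> Hol k G = c <#\<^bsub>sym_group k\<^esub> Hol k G"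
proof -
  interpret B: group "sym_group k" by (rule sym_group_is_group)
  define h where "h = inv\<^bsub>sym_group k\<^esub> c \<otimes>\<^bsub>sym_group k\<^esub> b"
  have h: "h \<in> carrier (sym_group k)" using b c by (simp add: h_def del: sym_group_inv_equality)
  have hol: "subgroup (Hol k G) (sym_group k)"
    unfolding Hol_def by (rule B.normalizer_imp_subgroup[OF G])
  have conj: "x <#\<^bsub>sym_group k\<^esub> G #>\<^bsub>sym_group k\<^esub> inv\<^bsub>sym_group k\<^esub> x
      = (\<lambda>g. x \<otimes>\<^bsub>sym_group k\<^esub> g \<otimes>\<^bsub>sym_group k\<^esub> inv\<^bsub>sym_group k\<^esub> x) ` G" for x
    by (auto simp: l_coset_def r_coset_def)
  have "h <#\<^bsub>sym_group k\<^esub> G #>\<^bsub>sym_group k\<^esub> inv\<^bsub>sym_group k\<^esub> h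
     = (\<lambda>g. inv\<^bsub>sym_group k\<^esub> c \<otimes>\<^bsub>sym_group k\<^esub> g \<otimes>\<^bsub>sym_group k\<^esub> c) `
         (b <#\<^bsub>sym_group k\<^esub> G #>\<^bsub>sym_group k\<^esub> inv\<^bsub>sym_group k\<^esub> b)"
    unfolding conj image_image h_def using G b c
    by (intro image_cong)
       (auto simp: B.m_assoc B.inv_mult_group subset_iff simp del: sym_group_inv_equality)
  also have "\<dots> = (\<lambda>g. g) ` G"
    unfolding eq unfolding conj image_image using G c
    by (intro image_cong)
       (auto simp: B.m_assoc B.inv_solve_left' subset_iff simp del: sym_group_inv_equality)
  finally have "h \<in> Hol k G"
    using h G by (simp add: Hol_def normalizer_def stabilizer_def del: sym_group_inv_equality)
  then have "h <#\<^bsub>sym_group k\<^esub> Hol k G = Hol k G"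
    using hol h B.lcos_mult_one B.l_repr_independence
    by (metis B.one_closed subgroup.subset)
  moreover have "b = c \<otimes>\<^bsub>sym_group k\<^esub> h"
    using b c by (simp add: h_def B.m_assoc[symmetric] del: sym_group_inv_equality)
  ultimately show ?thesis
    using B.lcos_m_assoc[OF subgroup.subset[OF hol] c h] by simp
qed

lemma QHol_eq:
  assumes G: "G \<subseteq> carrier (sym_group k)" and P: "is_pi_Q k G P"
  shows "QHol k G = (\<Union>b\<in>P. b <#\<^bsub>sym_group k\<^esub> Hol k G)"
proof -
  have sub: "(\<Union>b\<in>P1. b <#\<^bsub>sym_group k\<^esub> Hol k G) \<subseteq> (\<Union>b\<in>P2. b <#\<^bsub>sym_group k\<^esub> Hol k G)"
    if P1: "is_pi_Q k G P1" and P2: "is_pi_Q k G P2" for P1 P2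
  proof (intro UN_least)
    fix b assume bP: "b \<in> P1"
    then have "b <#\<^bsub>sym_group k\<^esub> G #>\<^bsub>sym_group k\<^esub> inv\<^bsub>sym_group k\<^esub> b \<in> Q_set k G"
      using P1 unfolding is_pi_Q_def by blast
    then obtain c where c: "c \<in> P2"
      and eq: "b <#\<^bsub>sym_group k\<^esub> G #>\<^bsub>sym_group k\<^esub> inv\<^bsub>sym_group k\<^esub> b
             = c <#\<^bsub>sym_group k\<^esub> G #>\<^bsub>sym_group k\<^esub> inv\<^bsub>sym_group k\<^esub> c"
      using P2 unfolding is_pi_Q_def by blast
    have "b \<in> carrier (sym_group k)" "c \<in> carrier (sym_group k)"
      using bP c P1 P2 unfolding is_pi_Q_def by blast+
    from coset_Hol_eqI[OF G this eq] c
    show "b <#\<^bsub>sym_group k\<^esub> Hol k G \<subseteq> (\<Union>b\<in>P2. b <#\<^bsub>sym_group k\<^esub> Hol k G)" by blast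
  qed
  have "is_pi_Q k G (SOME P. is_pi_Q k G P)" using P by (rule someI)
  from sub[OF this P] sub[OF P this] show ?thesis unfolding QHol_def by blast
qed

definition zappa_szep_product :: "('a, 'b) monoid_scheme \<Rightarrow> 'a set \<Rightarrow> 'a set \<Rightarrow> 'a set \<Rightarrow> bool" where
  "zappa_szep_product B K P H \<longleftrightarrow>
     subgroup K B \<and> subgroup P B \<and> subgroup H B \<and>
     K = P <#>\<^bsub>B\<^esub> H \<and> P \<inter> H = {\<one>\<^bsub>B\<^esub>}"

definition full_cycle :: "nat \<Rightarrow> nat \<Rightarrow> nat" where
  "full_cycle k = cycle_of_list [1..<Suc k]"

text \<open>\<open>sigma_part p n m i\<close> is the cycle
  \<open>\<sigma>\<^sub>i = (i, i + p^(n-m), \<dots>, i + (p^m - 1) p^(n-m))\<close>.\<close>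

definition sigma_part :: "nat \<Rightarrow> nat \<Rightarrow> nat \<Rightarrow> nat \<Rightarrow> nat \<Rightarrow> nat" where
  "sigma_part p n m i = cycle_of_list (map (\<lambda>j. i + j * p ^ (n - m)) [0..<p ^ m])"

definition tri :: "nat \<Rightarrow> nat" where
  "tri j = j * (j + 1) div 2"

text \<open>The factors have disjoint supports, so their order is immaterial.\<close>

definition beta_perm :: "nat \<Rightarrow> nat \<Rightarrow> nat \<Rightarrow> nat \<Rightarrow> nat" where
  "beta_perm p n m =
     foldr (\<circ>) (map (\<lambda>i. sigma_part p n m i ^^ tri (i - 1)) [1..<Suc (p ^ (n - m))]) id"

end

theory Submission
  imports Defs "HOL-Algebra.Multiplicative_Group" "HOL-Number_Theory.Cong"
begin

text \<open>
  On residues modulo \<open>k = p ^ n\<close> the cycle \<open>\<sigma>\<close> is \<open>x \<mapsto> x + 1\<close>, the holomorph of \<open>G\<close> consists of the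
  affine permutations, and, with \<open>q = p ^ (n - m)\<close>, \<open>\<beta>\<close> is \<open>x \<mapsto> x + q x (x - 1) / 2\<close>. As \<open>k\<close> divides
  \<open>q\<^sup>2\<close>, the conjugate of \<open>\<sigma>\<close> by \<open>\<beta> ^ e\<close> is the affine map \<open>x \<mapsto> (1 + e q) x + 1\<close>.
  Conversely, a group \<open>N\<close> in \<open>S(G) \<inter> R(G)\<close> contains a map \<open>x \<mapsto> a x + 1\<close>; it commutes with its
  conjugate under \<open>\<sigma>\<close>, so \<open>k\<close> divides \<open>(a - 1)\<^sup>2\<close>, hence \<open>q\<close> divides \<open>a - 1\<close> and \<open>N\<close> is a conjugate of
  \<open>G\<close> by a power of \<open>\<beta>\<close>. Thus \<open>S(G) \<inter> R(G)\<close> is the orbit of \<open>G\<close> under \<open>\<langle>\<beta>\<rangle>\<close>. Its members normalize each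
  other, since conjugation by a power of \<open>\<beta>\<close> reduces this to their normalizing \<open>G\<close>; so it equals \<open>Q(G)\<close>. It is stable under the holomorph,
  so \<open>\<langle>\<beta>\<rangle> Hol(G)\<close> is closed under products.
\<close>

subsection \<open>Conjugation of subsets\<close>

context group
begin

abbreviation conj_set :: "'a \<Rightarrow> 'a set \<Rightarrow> 'a set" where
  "conj_set b S \<equiv> b <# S #> inv b"

lemma conj_set_eq_image: "conj_set b S = (\<lambda>g. b \<otimes> g \<otimes> inv b) ` S"
  by (auto simp: l_coset_def r_coset_def)

lemma conj_set_subset_carrier:
  "\<lbrakk>b \<in> carrier G; S \<subseteq> carrier G\<rbrakk> \<Longrightarrow> conj_set b S \<subseteq> carrier G"
  by (auto simp: conj_set_eq_image)

lemma conj_set_mono: "S \<subseteq> T \<Longrightarrow> conj_set b S \<subseteq> conj_set b T"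
  by (auto simp: conj_set_eq_image)

lemma conj_set_one:
  assumes "S \<subseteq> carrier G"
  shows "\<one> <# S #> \<one> = S"
proof -
  have "(\<lambda>g. \<one> \<otimes> g \<otimes> inv \<one>) ` S = (\<lambda>g. g) ` S"
    using assms by (intro image_cong) auto
  then show ?thesis using conj_set_eq_image[of \<one> S] by simp
qed

lemma conj_set_mult:
  assumes "a \<in> carrier G" "b \<in> carrier G" "S \<subseteq> carrier G"
  shows "conj_set (a \<otimes> b) S = conj_set a (conj_set b S)"
  unfolding conj_set_eq_image image_image using assms
  by (intro image_cong) (auto simp: m_assoc inv_mult_group subset_iff)

lemma conj_set_inv:
  assumes "b \<in> carrier G" "S \<subseteq> carrier G"
  shows "inv b <# conj_set b S #> b = S" "conj_set b (inv b <# S #> b) = S"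
  using assms conj_set_mult[of "inv b" b S] conj_set_mult[of b "inv b" S] conj_set_one[of S]
  by simp_all

lemma inv_mult_cancel_left: "\<lbrakk>a \<in> carrier G; x \<in> carrier G\<rbrakk> \<Longrightarrow> inv a \<otimes> (a \<otimes> x) = x"
  by (simp flip: m_assoc)

lemma mem_normalizer_iff:
  "S \<subseteq> carrier G \<Longrightarrow> g \<in> normalizer G S \<longleftrightarrow> g \<in> carrier G \<and> conj_set g S = S"
  by (auto simp: normalizer_def stabilizer_def)

lemma normalizer_subset_carrier: "normalizer G S \<subseteq> carrier G"
  by (auto simp: normalizer_def stabilizer_def)

text \<open>Pulling \<open>H\<close> back along conjugation by \<open>a\<close> gives a subgroup
  again, so it contains the group generated by \<open>s\<close> as soon as it contains
  \<open>s\<close>.\<close>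

lemma conj_set_generate_subset:
  assumes "a \<in> carrier G" "s \<in> carrier G" "subgroup H G" "a \<otimes> s \<otimes> inv a \<in> H"
  shows "conj_set a (generate G {s}) \<subseteq> H"
proof -
  have H: "H \<subseteq> carrier G" using assms(3) subgroup.subset by blast
  have "s = inv a \<otimes> (a \<otimes> s \<otimes> inv a) \<otimes> inv (inv a)"
    using assms(1,2) by (simp add: m_assoc inv_mult_cancel_left)
  then have "s \<in> conj_set (inv a) H"
    using assms(4) unfolding conj_set_eq_image by blast
  then have "generate G {s} \<subseteq> conj_set (inv a) H"
    using subgroup_conjugation_is_surj2[of "inv a" H] assms generate_subgroup_incl by simp
  then show ?thesis
    using conj_set_mono[of _ _ a] conj_set_inv(2)[OF assms(1) H] assms(1)
    by (metis inv_inv)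
qed

text \<open>Conjugation is injective, so in a finite group the inclusion obtained from the generator
  is an equality by counting.\<close>

lemma mem_normalizer_generateI:
  assumes "finite (carrier G)" "a \<in> carrier G" "s \<in> carrier G"
    and "a \<otimes> s \<otimes> inv a \<in> generate G {s}"
  shows "a \<in> normalizer G (generate G {s})"
proof -
  have sub: "subgroup (generate G {s}) G" using assms generate_is_subgroup by simp
  then have carr: "generate G {s} \<subseteq> carrier G" by (rule subgroup.subset)
  have "conj_set a (generate G {s}) \<subseteq> generate G {s}"
    using conj_set_generate_subset assms sub by blast
  moreover have "card (conj_set a (generate G {s})) = card (generate G {s})"
    unfolding conj_set_eq_image using assms(2) carr conjugation_is_inj
    by (intro card_image inj_onI) blast
  ultimately have "conj_set a (generate G {s}) = generate G {s}"
    using card_subset_eq finite_subset[OF carr assms(1)] by metis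
  then show ?thesis using mem_normalizer_iff carr assms(2) by simp
qed

text \<open>Conjugation by \<open>b\<close> is an automorphism of the ambient group and hence
  transports the relation of normalizing.\<close>

lemma conj_set_normalizer_mono:
  assumes "b \<in> carrier G" "N \<subseteq> carrier G" "M \<subseteq> carrier G" "N \<subseteq> normalizer G M"
  shows "conj_set b N \<subseteq> normalizer G (conj_set b M)"
proof
  fix x assume "x \<in> conj_set b N"
  then obtain g where g: "g \<in> N" "x = b \<otimes> g \<otimes> inv b" by (auto simp: conj_set_eq_image)
  have gM: "conj_set g M = M" "g \<in> carrier G" using g assms mem_normalizer_iff by auto
  have "conj_set x (conj_set b M) = conj_set (x \<otimes> b) M"
    using g gM assms by (simp add: conj_set_mult)
  also have "x \<otimes> b = b \<otimes> g" using g gM assms by (simp add: m_assoc)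
  also have "conj_set (b \<otimes> g) M = conj_set b M" using gM assms by (simp add: conj_set_mult)
  finally show "x \<in> normalizer G (conj_set b M)"
    using g gM assms by (simp add: mem_normalizer_iff conj_set_subset_carrier)
qed

lemma conj_set_iso:
  assumes "b \<in> carrier G" "N \<subseteq> carrier G" "group (G\<lparr>carrier := N\<rparr>)"
  shows "G\<lparr>carrier := conj_set b N\<rparr> \<cong> G\<lparr>carrier := N\<rparr>"
proof -
  have "(\<lambda>g. b \<otimes> g \<otimes> inv b) \<in> iso (G\<lparr>carrier := N\<rparr>) (G\<lparr>carrier := conj_set b N\<rparr>)"
  proof (rule isoI)
    show "(\<lambda>g. b \<otimes> g \<otimes> inv b) \<in> hom (G\<lparr>carrier := N\<rparr>) (G\<lparr>carrier := conj_set b N\<rparr>)"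
      using assms by (auto simp: hom_def conj_set_eq_image m_assoc inv_mult_cancel_left subset_iff)
    show "bij_betw (\<lambda>g. b \<otimes> g \<otimes> inv b) (carrier (G\<lparr>carrier := N\<rparr>))
        (carrier (G\<lparr>carrier := conj_set b N\<rparr>))"
      using conjugation_is_inj[OF assms(1) subsetD[OF assms(2)] subsetD[OF assms(2)]]
      by (auto simp: bij_betw_def conj_set_eq_image intro!: inj_onI)
  qed
  then have "G\<lparr>carrier := N\<rparr> \<cong> G\<lparr>carrier := conj_set b N\<rparr>" by (rule is_isoI)
  then show ?thesis using group.iso_sym assms(3) by blast
qed

text \<open>Trivial intersection separates the cosets. For the product, stability says that the
  normalizer permutes the orbit of \<open>S\<close> under \<open>P\<close>, so the elements carrying
  \<open>S\<close> into this orbit form a group.\<close>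

lemma subgroup_transversal_mult_normalizer:
  assumes P: "subgroup P G" and S: "S \<subseteq> carrier G"
    and one: "P \<inter> normalizer G S = {\<one>}"
    and stable: "\<And>h c. \<lbrakk>h \<in> normalizer G S; c \<in> P\<rbrakk>
      \<Longrightarrow> conj_set h (conj_set c S) \<in> (\<lambda>c. conj_set c S) ` P"
  shows "inj_on (\<lambda>b. b <# normalizer G S) P" "subgroup (P <#> normalizer G S) G"
proof -
  let ?H = "normalizer G S" and ?Q = "(\<lambda>c. conj_set c S) ` P"
  have H: "subgroup ?H G" by (rule normalizer_imp_subgroup[OF S])
  have Pc: "c \<in> carrier G" if "c \<in> P" for c using P that by (rule subgroup.mem_carrier)
  show "inj_on (\<lambda>b. b <# ?H) P"
  proof (rule inj_onI)
    fix b c assume bc: "b \<in> P" "c \<in> P" "b <# ?H = c <# ?H"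
    have "b \<in> b <# ?H" using H bc(1) Pc by (force simp: l_coset_def dest: subgroup.one_closed)
    then obtain h where h: "h \<in> ?H" "b = c \<otimes> h" using bc by (auto simp: l_coset_def)
    then have "h = inv c \<otimes> b"
      using Pc bc normalizer_subset_carrier by (auto simp: inv_solve_left subset_iff)
    then have "h \<in> P" using bc P subgroup.m_closed subgroup.m_inv_closed by metis
    with h one have "h = \<one>" by blast
    with h Pc bc show "b = c" by simp
  qed
  \<comment> \<open>Membership in the product depends only on where \<open>x\<close> carries
    \<open>S\<close>: elements with the same image of \<open>S\<close> differ by a right factor from
    the normalizer.\<close>
  have K: "x \<in> P <#> ?H \<longleftrightarrow> x \<in> carrier G \<and> conj_set x S \<in> ?Q" for x
  proof
    assume "x \<in> P <#> ?H"
    then obtain c h where ch: "c \<in> P" "h \<in> ?H" "x = c \<otimes> h" by (auto simp: set_mult_def)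
    then show "x \<in> carrier G \<and> conj_set x S \<in> ?Q"
      using Pc S mem_normalizer_iff[OF S, of h] by (auto simp: conj_set_mult)
  next
    assume x: "x \<in> carrier G \<and> conj_set x S \<in> ?Q"
    then obtain c where c: "c \<in> P" "conj_set x S = conj_set c S" by blast
    then have "conj_set (inv c \<otimes> x) S = S" using x Pc S by (simp add: conj_set_mult conj_set_inv)
    then have "inv c \<otimes> x \<in> ?H" using x c Pc S by (simp add: mem_normalizer_iff)
    moreover have "x = c \<otimes> (inv c \<otimes> x)" using x c Pc by (simp flip: m_assoc)
    ultimately show "x \<in> P <#> ?H" using c unfolding set_mult_def by blast
  qed
  show "subgroup (P <#> ?H) G"
  proof
    show "P <#> ?H \<subseteq> carrier G" using K by blast
    have "\<one> \<in> P" using P by (rule subgroup.one_closed)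
    then show "\<one> \<in> P <#> ?H" unfolding K by blast
  next
    fix x y assume xy: "x \<in> P <#> ?H" "y \<in> P <#> ?H"
    then obtain c h where ch: "c \<in> P" "h \<in> ?H" "x = c \<otimes> h" by (auto simp: set_mult_def)
    obtain d where d: "d \<in> P" "conj_set y S = conj_set d S" using xy K by blast
    obtain e where e: "e \<in> P" "conj_set h (conj_set d S) = conj_set e S"
      using stable ch d by blast
    have carr: "c \<in> carrier G" "h \<in> carrier G" "e \<in> carrier G" "y \<in> carrier G" "d \<in> carrier G"
      using ch d e Pc xy K normalizer_subset_carrier by blast+
    have "conj_set (x \<otimes> y) S = conj_set (c \<otimes> e) S"
      using carr S ch d e by (simp add: conj_set_mult conj_set_subset_carrier)
    moreover have "c \<otimes> e \<in> P" using P ch e by (simp add: subgroup.m_closed)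
    ultimately show "x \<otimes> y \<in> P <#> ?H" using K carr ch by auto
  next
    fix x assume "x \<in> P <#> ?H"
    then obtain c h where ch: "c \<in> P" "h \<in> ?H" "x = c \<otimes> h" by (auto simp: set_mult_def)
    have carr: "c \<in> carrier G" "h \<in> carrier G"
      using ch Pc normalizer_subset_carrier by blast+
    have "conj_set (inv h) (conj_set (inv c) S) \<in> ?Q"
      using stable ch P H by (simp add: subgroup.m_inv_closed)
    then show "inv x \<in> P <#> ?H"
      using K carr ch S conj_set_mult[of "inv h" "inv c" S] by (simp add: inv_mult_group)
  qed
qed

end

subsection \<open>Permutations as functions on residues\<close>

text \<open>\<open>F\<close> matters only modulo \<open>k\<close>, so polynomial formulas can be
  used without reducing their values. The residue 0 is represented by the point
  \<open>k\<close>.\<close>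

definition represents :: "nat \<Rightarrow> (int \<Rightarrow> int) \<Rightarrow> (nat \<Rightarrow> nat) \<Rightarrow> bool" where
  "represents k F f \<longleftrightarrow> f permutes {1..k} \<and> (\<forall>x\<in>{1..k}. [int (f x) = F (int x)] (mod int k))"

lemma representsD: "\<lbrakk>represents k F f; x \<in> {1..k}\<rbrakk> \<Longrightarrow> [int (f x) = F (int x)] (mod int k)"
  by (simp add: represents_def)

lemma represents_permutes: "represents k F f \<Longrightarrow> f permutes {1..k}"
  by (simp add: represents_def)

lemma represents_in: "\<lbrakk>represents k F f; x \<in> {1..k}\<rbrakk> \<Longrightarrow> f x \<in> {1..k}"
  using represents_permutes permutes_in_image by metis

lemma represents_carrier: "represents k F f \<Longrightarrow> f \<in> carrier (sym_group k)"
  by (simp add: represents_def sym_group_carrier)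

lemma represents_cong:
  assumes "represents k F f" "\<And>x. x \<in> {1..k} \<Longrightarrow> [F (int x) = F' (int x)] (mod int k)"
  shows "represents k F' f"
  using assms cong_trans unfolding represents_def by blast

lemma cong_atLeastAtMost_eq:
  assumes "x \<in> {1..k}" "y \<in> {1..k}" "[int x = int y] (mod int k)"
  shows "x = y"
proof -
  have "int k dvd int x - int y" using assms(3) by (simp add: cong_iff_dvd_diff)
  moreover have "\<bar>int x - int y\<bar> < int k" using assms(1,2) by auto
  ultimately have "int x - int y = 0" using dvd_imp_le_int[of "int x - int y" "int k"] by linarith
  then show ?thesis by simp
qed

lemma represents_unique:
  assumes "represents k F f" "represents k F g"
  shows "f = g"
proof
  fix x
  show "f x = g x"
  proof (cases "x \<in> {1..k}")
    case True
    then have "[int (f x) = int (g x)] (mod int k)"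
      using assms representsD cong_trans cong_sym by metis
    then show ?thesis using cong_atLeastAtMost_eq represents_in assms True by blast
  next
    case False
    then show ?thesis using assms represents_permutes permutes_not_in by metis
  qed
qed

lemma represents_id: "represents k (\<lambda>x. x) id"
  by (simp add: represents_def permutes_id)

lemma represents_comp:
  assumes "represents k F f" "represents k F' g"
    and "\<And>x y. [x = y] (mod int k) \<Longrightarrow> [F x = F y] (mod int k)"
  shows "represents k (\<lambda>x. F (F' x)) (f \<circ> g)"
  unfolding represents_def
proof (intro conjI ballI)
  show "f \<circ> g permutes {1..k}" using assms represents_permutes permutes_compose by blast
next
  fix x assume x: "x \<in> {1..k}"
  have "[int (f (g x)) = F (int (g x))] (mod int k)"
    using representsD[OF assms(1)] represents_in[OF assms(2) x] by blast
  also have "[F (int (g x)) = F (F' (int x))] (mod int k)"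
    using assms(3) representsD[OF assms(2) x] by blast
  finally show "[int ((f \<circ> g) x) = F (F' (int x))] (mod int k)" by simp
qed

text \<open>The intertwining relation identifies the conjugate without a formula for the inverse of
  \<open>F\<close>.\<close>

lemma represents_conj:
  assumes f: "represents k F f" and g: "represents k H g"
    and F: "\<And>x y. [x = y] (mod int k) \<Longrightarrow> [F x = F y] (mod int k)"
    and K: "\<And>x y. [x = y] (mod int k) \<Longrightarrow> [K x = K y] (mod int k)"
    and intertwine: "\<And>x. [F (H x) = K (F x)] (mod int k)"
  shows "represents k K (f \<otimes>\<^bsub>sym_group k\<^esub> g \<otimes>\<^bsub>sym_group k\<^esub> inv\<^bsub>sym_group k\<^esub> f)"
proof -
  have perm: "f permutes {1..k}" "g permutes {1..k}" using f g represents_permutes by blast+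
  have "f \<otimes>\<^bsub>sym_group k\<^esub> g \<otimes>\<^bsub>sym_group k\<^esub> inv\<^bsub>sym_group k\<^esub> f
      = f \<circ> g \<circ> Hilbert_Choice.inv f"
    using f represents_carrier by (simp add: sym_group_mult)
  moreover have "represents k K (f \<circ> g \<circ> Hilbert_Choice.inv f)"
    unfolding represents_def
  proof (intro conjI ballI)
    show "f \<circ> g \<circ> Hilbert_Choice.inv f permutes {1..k}"
      using perm permutes_inv permutes_compose by blast
    fix x assume x: "x \<in> {1..k}"
    define y where "y = Hilbert_Choice.inv f x"
    have y: "y \<in> {1..k}" "x = f y"
      using x permutes_in_image[OF permutes_inv[OF perm(1)]] permutes_inverses[OF perm(1)]
      by (auto simp: y_def)
    have "[int (f (g y)) = F (int (g y))] (mod int k)"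
      using representsD[OF f] represents_in[OF g] y by blast
    also have "[F (int (g y)) = F (H (int y))] (mod int k)" using F representsD[OF g] y by blast
    also have "[F (H (int y)) = K (F (int y))] (mod int k)" by (rule intertwine)
    also have "[K (F (int y)) = K (int x)] (mod int k)"
      using K representsD[OF f] y cong_sym by blast
    finally show "[int ((f \<circ> g \<circ> Hilbert_Choice.inv f) x) = K (int x)] (mod int k)"
      by (simp add: y_def)
  qed
  ultimately show ?thesis by simp
qed

subsection \<open>The permutation \<open>\<beta>\<close>\<close>

lemma cycle_of_list_funpow_nth:
  assumes "distinct cs" "j < length cs"
  shows "(cycle_of_list cs ^^ t) (cs ! j) = cs ! ((t + j) mod length cs)"
proof -
  have "map (cycle_of_list cs ^^ t) cs ! j = rotate t cs ! j"
    using cyclic_rotation[OF assms(1)] by metis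
  then show ?thesis using assms(2) by (simp add: nth_rotate)
qed

lemma represents_full_cycle: "represents k (\<lambda>x. x + 1) (full_cycle k)"
  unfolding represents_def
proof (intro conjI ballI)
  show "full_cycle k permutes {1..k}"
    using cycle_permutes[of "[1..<Suc k]"]
    by (simp add: full_cycle_def atLeastLessThanSuc_atLeastAtMost del: upt_Suc)
  fix x assume x: "x \<in> {1..k}"
  \<comment> \<open>The point \<open>x\<close> has list index \<open>x - 1\<close>; the reduction
    modulo \<open>k\<close> wraps the point \<open>k\<close> around to 1.\<close>
  then have "x - 1 < k" by auto
  with x have "full_cycle k x = 1 + (1 + (x - 1)) mod k"
    using cycle_of_list_funpow_nth[of "[1..<Suc k]" "x - 1" 1]
    by (simp add: full_cycle_def del: upt_Suc)
  then have "int (full_cycle k x) = 1 + int x mod int k" using x by (simp add: zmod_int)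
  then show "[int (full_cycle k x) = int x + 1] (mod int k)"
    by (simp add: cong_def mod_add_eq add.commute mod_simps)
qed

text \<open>Factors to the right of \<open>f i\<close> act on \<open>x\<close> and those to the left
  act on \<open>f i x\<close>, so both points must be fixed by the other factors.\<close>

lemma foldr_comp_disjoint:
  assumes "distinct is" "i \<in> set is"
    and "\<And>j. j \<in> set is \<Longrightarrow> j \<noteq> i \<Longrightarrow> f j x = x" "\<And>j. j \<in> set is \<Longrightarrow> j \<noteq> i \<Longrightarrow> f j (f i x) = f i x"
  shows "foldr (\<circ>) (map f is) id x = f i x"
proof -
  have fix_out: "foldr (\<circ>) (map f js) id x = x" if "\<And>j. j \<in> set js \<Longrightarrow> f j x = x" for js
    using that by (induction js) auto
  show ?thesis using assms
  proof (induction "is")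
    case (Cons j js)
    show ?case
    proof (cases "j = i")
      case True
      then have "foldr (\<circ>) (map f js) id x = x"
        using Cons.prems(1,3) by (intro fix_out) auto
      moreover have "foldr (\<circ>) (map f (j # js)) id x = f j (foldr (\<circ>) (map f js) id x)"
        by simp
      ultimately show ?thesis using True by metis
    next
      case False
      then show ?thesis using Cons by auto
    qed
  qed simp
qed

lemma permutes_foldr_comp:
  assumes "\<And>i. i \<in> set is \<Longrightarrow> f i permutes S"
  shows "foldr (\<circ>) (map f is) id permutes S"
  using assms by (induction "is") (auto simp: permutes_id intro: permutes_compose)

lemma sigma_part_permutes:
  assumes "m \<le> n" "p > 0" "i \<in> {1..p ^ (n - m)}"
  shows "sigma_part p n m i permutes {1..p ^ n}"
proof -
  have "i + j * p ^ (n - m) \<in> {1..p ^ n}" if "j < p ^ m" for j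
  proof -
    have "i + j * p ^ (n - m) \<le> (j + 1) * p ^ (n - m)" using assms by simp
    also have "\<dots> \<le> p ^ m * p ^ (n - m)" using that by (intro mult_right_mono) auto
    also have "\<dots> = p ^ n" using assms by (simp flip: power_add)
    finally show ?thesis using assms by simp
  qed
  then have "set (map (\<lambda>j. i + j * p ^ (n - m)) [0..<p ^ m]) \<subseteq> {1..p ^ n}" by auto
  then show ?thesis unfolding sigma_part_def using cycle_permutes permutes_subset by blast
qed

lemma sigma_part_funpow:
  assumes "p > 0" "j < p ^ m"
  shows "(sigma_part p n m i ^^ t) (i + j * p ^ (n - m)) = i + (t + j) mod p ^ m * p ^ (n - m)"
proof -
  define cs where "cs = map (\<lambda>j. i + j * p ^ (n - m)) [0..<p ^ m]"
  have "distinct cs" using assms by (auto simp: cs_def distinct_map intro!: inj_onI)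
  moreover have "(t + j) mod p ^ m < p ^ m" using assms by simp
  ultimately show ?thesis
    using cycle_of_list_funpow_nth[of cs j t] assms by (simp add: cs_def sigma_part_def)
qed

lemma sigma_part_funpow_outside:
  assumes "p > 0" "[x \<noteq> i] (mod p ^ (n - m))"
  shows "(sigma_part p n m i ^^ t) x = x"
proof -
  have "x \<notin> set (map (\<lambda>j. i + j * p ^ (n - m)) [0..<p ^ m])"
    using assms(2) by (auto simp: cong_def)
  then have "sigma_part p n m i x = x" unfolding sigma_part_def by (rule id_outside_supp)
  then show ?thesis by (induction t) auto
qed

lemma beta_perm_apply:
  assumes "m \<le> n" "p > 0" "i \<in> {1..p ^ (n - m)}" "j < p ^ m"
  shows "beta_perm p n m (i + j * p ^ (n - m))
       = i + (tri (i - 1) + j) mod p ^ m * p ^ (n - m)"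
proof -
  \<comment> \<open>Distinct indices in \<open>{1..p ^ (n - m)}\<close> are incongruent modulo
    \<open>p ^ (n - m)\<close>, so the other cycles fix the whole residue class of \<open>i\<close>,
    in particular the point and its image.\<close>
  have other: "(sigma_part p n m i' ^^ t) (i + j' * p ^ (n - m)) = i + j' * p ^ (n - m)"
    if "i' \<in> {1..p ^ (n - m)}" "i' \<noteq> i" for i' t j'
  proof (rule sigma_part_funpow_outside)
    have "\<not> [int i = int i'] (mod int (p ^ (n - m)))"
      using cong_atLeastAtMost_eq that assms(3) by blast
    then show "[i + j' * p ^ (n - m) \<noteq> i'] (mod p ^ (n - m))"
      by (metis cong_def cong_int_iff mod_mult_self1)
  qed (use assms in auto)
  have "beta_perm p n m (i + j * p ^ (n - m))
      = (sigma_part p n m i ^^ tri (i - 1)) (i + j * p ^ (n - m))"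
    unfolding beta_perm_def
    using assms other
    by (intro foldr_comp_disjoint) (auto simp: sigma_part_funpow simp del: upt_Suc)
  then show ?thesis using sigma_part_funpow assms by simp
qed

text \<open>The shifted index turns the triangular exponent into the binomial coefficient "i choose
  2".\<close>

lemma int_tri: "i \<ge> 1 \<Longrightarrow> int (tri (i - 1)) = int i * (int i - 1) div 2"
  by (simp add: tri_def zdiv_int of_nat_diff mult.commute)

text \<open>A shift of \<open>x\<close> by a multiple of \<open>q\<close> changes
  \<open>x * (x - 1)\<close> by a multiple of \<open>q\<close>. The first assumption controls the
  loss from halving, and the factor \<open>q\<close> lifts the result to the modulus
  \<open>q * r\<close>.\<close>

lemma cong_mult_binomial2:
  fixes q r x y :: int
  assumes "\<And>z. q dvd 2 * z \<Longrightarrow> r dvd z" "[x = y] (mod q)"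
  shows "[q * (x * (x - 1) div 2) = q * (y * (y - 1) div 2)] (mod q * r)"
proof -
  let ?z = "x * (x - 1) div 2 - y * (y - 1) div 2"
  have "2 * (x * (x - 1) div 2) = x * (x - 1)" "2 * (y * (y - 1) div 2) = y * (y - 1)" by auto
  then have "2 * ?z = (x - y) * (x + y - 1)" by (simp add: algebra_simps)
  then have "q dvd 2 * ?z" using assms(2) by (simp add: cong_iff_dvd_diff)
  then have "q * r dvd q * ?z" using assms(1) by simp
  then show ?thesis by (simp add: cong_iff_dvd_diff right_diff_distrib)
qed

lemma represents_beta_perm:
  assumes "m \<le> n" "p > 0" "\<And>z. int (p ^ (n - m)) dvd 2 * z \<Longrightarrow> int (p ^ m) dvd z"
  shows "represents (p ^ n) (\<lambda>x. x + int (p ^ (n - m)) * (x * (x - 1) div 2)) (beta_perm p n m)"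
  unfolding represents_def
proof (intro conjI ballI)
  show "beta_perm p n m permutes {1..p ^ n}"
    unfolding beta_perm_def using assms
    by (intro permutes_foldr_comp permutes_funpow sigma_part_permutes) auto
  fix x assume x: "x \<in> {1..p ^ n}"
  let ?q = "p ^ (n - m)"
  have qr: "p ^ n = ?q * p ^ m" using assms(1) by (simp flip: power_add)
  \<comment> \<open>Division with remainder is applied to \<open>x - 1\<close> because the cycles
    are indexed from 1: \<open>i\<close> selects the cycle and \<open>j\<close> is the position in
    it.\<close>
  define i j where "i = 1 + (x - 1) mod ?q" and "j = (x - 1) div ?q"
  have ij: "x = i + j * ?q" using x div_mult_mod_eq[of "x - 1" ?q]
    unfolding i_def j_def atLeastAtMost_iff by linarith
  have i: "i \<in> {1..?q}" using assms(2) by (auto simp: i_def Suc_le_eq)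
  have j: "j < p ^ m" using x qr assms(2) by (auto simp: j_def less_mult_imp_div_less mult.commute)
  have "int (beta_perm p n m x) = int i + int ?q * ((int (tri (i - 1)) + int j) mod int (p ^ m))"
    using beta_perm_apply[OF assms(1,2) i j] ij by (simp add: zmod_int)
  also have "\<dots> = int i + (int ?q * (int (tri (i - 1)) + int j)) mod int (p ^ n)"
    unfolding qr by (simp only: of_nat_mult mult_mod_right)
  also have "[\<dots> = int i + int ?q * (int (tri (i - 1)) + int j)] (mod int (p ^ n))"
    by (simp add: cong_def mod_simps)
  also have "int i + int ?q * (int (tri (i - 1)) + int j)
      = int x + int ?q * (int i * (int i - 1) div 2)"
    using i int_tri[of i] by (simp add: ij distrib_left)
  \<comment> \<open>Since \<open>x\<close> and \<open>i\<close> agree modulo \<open>?q\<close>, the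
    binomial coefficient of \<open>i\<close> may be replaced by that of \<open>x\<close>, which
    removes the case split by cycles.\<close>
  also have "[\<dots> = int x + int ?q * (int x * (int x - 1) div 2)] (mod int (p ^ n))"
    unfolding qr of_nat_mult
    by (intro cong_add cong_refl cong_mult_binomial2 assms(3)) (simp_all add: ij cong_iff_dvd_diff)
  finally show "[int (beta_perm p n m x) = int x + int ?q * (int x * (int x - 1) div 2)]
      (mod int (p ^ n))" .
qed

subsection \<open>Regular subgroups\<close>

lemma finite_carrier_sym_group: "finite (carrier (sym_group k))"
  by (simp add: sym_group_def finite_permutations)

lemma sym_group_nat_pow: "f [^]\<^bsub>sym_group k\<^esub> (j::nat) = f ^^ j"
proof (induction j)
  case 0
  show ?case by (simp add: nat_pow_def sym_group_one)
next
  case (Suc j)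
  then have "f [^]\<^bsub>sym_group k\<^esub> Suc j = f ^^ j \<circ> f" by (simp add: nat_pow_def sym_group_mult)
  then show ?case by (simp only: funpow_Suc_right)
qed

lemma generate_sym_group_singleton:
  assumes "f \<in> carrier (sym_group k)"
  shows "generate (sym_group k) {f} = range (\<lambda>j. f ^^ j)"
  using group.generate_pow_on_finite_carrier[OF sym_group_is_group finite_carrier_sym_group assms]
  by (auto simp: sym_group_nat_pow)

lemma regular_subgroup_iff:
  "regular_subgroup k N \<longleftrightarrow> subgroup N (sym_group k) \<and>
     (\<forall>x\<in>{1..k}. \<forall>y\<in>{1..k}. \<exists>g\<in>N. g x = y) \<and>
     (\<forall>x\<in>{1..k}. \<forall>g\<in>N. g x = x \<longrightarrow> g = id)"
proof -
  have "stabilizer (sym_group k\<lparr>carrier := N\<rparr>) (\<lambda>g. g) x = {\<one>\<^bsub>sym_group k\<^esub>}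
      \<longleftrightarrow> (\<forall>g\<in>N. g x = x \<longrightarrow> g = id)" if "subgroup N (sym_group k)" for x
    using subgroup.one_closed[OF that] by (force simp: stabilizer_def sym_group_one)
  then show ?thesis by (simp add: regular_subgroup_def cong: conj_cong)
qed

text \<open>For \<open>g\<close> in \<open>N\<close>, transitivity of \<open>M\<close> gives
  \<open>h\<close> in \<open>M\<close> with the same value at 1; the quotient of the two lies in
  \<open>N\<close> and fixes 1, so it is trivial.\<close>

lemma regular_subgroup_eqI:
  assumes "regular_subgroup k M" "regular_subgroup k N" "M \<subseteq> N" "k > 0"
  shows "M = N"
proof
  interpret B: group "sym_group k" by (rule sym_group_is_group)
  show "N \<subseteq> M"
  proof
    fix g assume g: "g \<in> N"
    have subM: "subgroup M (sym_group k)" and subN: "subgroup N (sym_group k)"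
      using assms by (auto simp: regular_subgroup_iff)
    have carr: "g \<in> carrier (sym_group k)" using g subN subgroup.mem_carrier by metis
    then have "g 1 \<in> {1..k}"
      using assms(4) permutes_in_image[of g "{1..k}" 1] by (simp add: sym_group_carrier)
    then obtain h where h: "h \<in> M" "h 1 = g 1"
      using assms(1,4) unfolding regular_subgroup_iff by force
    have hc: "h \<in> carrier (sym_group k)" using h subM subgroup.mem_carrier by metis
    have "inv\<^bsub>sym_group k\<^esub> h \<otimes>\<^bsub>sym_group k\<^esub> g \<in> N"
      using g h assms(3) subN by (blast intro: subgroup.m_closed subgroup.m_inv_closed)
    moreover have "(inv\<^bsub>sym_group k\<^esub> h \<otimes>\<^bsub>sym_group k\<^esub> g) 1 = 1"
      using hc h(2)[symmetric] permutes_inverses(2)[of h "{1..k}"]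
      by (simp add: sym_group_mult sym_group_carrier)
    ultimately have "inv\<^bsub>sym_group k\<^esub> h \<otimes>\<^bsub>sym_group k\<^esub> g = \<one>\<^bsub>sym_group k\<^esub>"
      using assms(2,4) unfolding regular_subgroup_iff by (force simp: sym_group_one)
    then have "g = h"
      using hc carr B.inv_solve_left' B.r_one B.one_closed by metis
    then show "g \<in> M" using h by simp
  qed
qed (use assms in blast)

lemma regular_subgroup_conj:
  assumes b: "b \<in> carrier (sym_group k)" and N: "regular_subgroup k N"
  shows "regular_subgroup k (b <#\<^bsub>sym_group k\<^esub> N #>\<^bsub>sym_group k\<^esub> inv\<^bsub>sym_group k\<^esub> b)"
    (is "regular_subgroup k ?M")
proof -
  interpret B: group "sym_group k" by (rule sym_group_is_group)
  have sub: "subgroup N (sym_group k)" using N by (simp add: regular_subgroup_iff)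
  have perm: "b permutes {1..k}" using b by (simp add: sym_group_carrier)
  have M: "?M = (\<lambda>g. b \<circ> g \<circ> Hilbert_Choice.inv b) ` N"
    using b B.conj_set_eq_image[of b N] by (simp add: sym_group_mult)
  have inX: "Hilbert_Choice.inv b x \<in> {1..k}" if "x \<in> {1..k}" for x
    using that permutes_in_image[OF permutes_inv[OF perm]] by blast
  show ?thesis unfolding regular_subgroup_iff
  proof (intro conjI ballI impI)
    show "subgroup ?M (sym_group k)" using B.subgroup_conjugation_is_surj2 b sub by blast
  next
    fix x y assume "x \<in> {1..k}" "y \<in> {1..k}"
    then obtain g where "g \<in> N" "g (Hilbert_Choice.inv b x) = Hilbert_Choice.inv b y"
      using N inX unfolding regular_subgroup_iff by metis
    then have "(b \<circ> g \<circ> Hilbert_Choice.inv b) x = y" by (simp add: permutes_inverses[OF perm])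
    then show "\<exists>g\<in>?M. g x = y" unfolding M using \<open>g \<in> N\<close> by blast
  next
    fix x h assume x: "x \<in> {1..k}" and h: "h \<in> ?M" "h x = x"
    then obtain g where g: "g \<in> N" "h = b \<circ> g \<circ> Hilbert_Choice.inv b" unfolding M by blast
    have "g (Hilbert_Choice.inv b x) = Hilbert_Choice.inv b x"
      using h(2) g(2) permutes_inverses[OF perm] by (metis comp_apply)
    then have "g = id" using g(1) N inX[OF x] unfolding regular_subgroup_iff by blast
    then show "h = id" using g(2) permutes_inv_o[OF perm] by simp
  qed
qed

subsection \<open>The holomorph of the cyclic group\<close>

locale cyclic_sym_group =
  fixes k :: nat
  assumes k: "k > 0"
begin

interpretation B: group "sym_group k" by (rule sym_group_is_group)

abbreviation (input) "\<sigma> \<equiv> full_cycle k"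
abbreviation (input) "G \<equiv> generate (sym_group k) {full_cycle k}"

lemma full_cycle_carrier: "\<sigma> \<in> carrier (sym_group k)"
  using represents_full_cycle by (rule represents_carrier)

lemma subgroup_cyclic: "subgroup G (sym_group k)"
  using full_cycle_carrier B.generate_is_subgroup by simp

lemma cyclic_subset_carrier: "G \<subseteq> carrier (sym_group k)"
  using subgroup_cyclic by (rule subgroup.subset)

lemma cyclic_eq: "G = range (\<lambda>j. \<sigma> ^^ j)"
  using generate_sym_group_singleton full_cycle_carrier by blast

lemma represents_full_cycle_funpow: "represents k (\<lambda>x. x + int j) (\<sigma> ^^ j)"
proof (induction j)
  case 0
  show ?case using represents_id[of k] by (simp add: id_def)
next
  case (Suc j)
  show ?case using represents_comp[OF represents_full_cycle Suc.IH]
    by (simp add: cong_add algebra_simps o_def)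
qed

lemma translation_mem_cyclic:
  assumes "represents k (\<lambda>x. x + c) f"
  shows "f \<in> G"
proof -
  have "represents k (\<lambda>x. x + c) (\<sigma> ^^ nat (c mod int k))"
    using k by (intro represents_cong[OF represents_full_cycle_funpow]) (auto simp: cong_def mod_simps)
  then have "f = \<sigma> ^^ nat (c mod int k)" using represents_unique assms by blast
  then show ?thesis unfolding cyclic_eq by blast
qed

text \<open>Since \<open>a * (x + 1) + b\<close> equals \<open>(a * x + b) + a\<close>, conjugation
  turns translation by 1 into translation by \<open>a\<close>, which lies in
  \<open>G\<close>.\<close>

lemma affine_mem_Hol:
  assumes "represents k (\<lambda>x. a * x + b) f"
  shows "f \<in> Hol k G"
proof -
  have "represents k (\<lambda>x. x + a)
      (f \<otimes>\<^bsub>sym_group k\<^esub> \<sigma> \<otimes>\<^bsub>sym_group k\<^esub> inv\<^bsub>sym_group k\<^esub> f)"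
    by (rule represents_conj[OF assms represents_full_cycle])
       (auto simp: algebra_simps intro!: cong_add cong_mult)
  then show ?thesis unfolding Hol_def
    using translation_mem_cyclic assms represents_carrier full_cycle_carrier finite_carrier_sym_group
    by (blast intro: B.mem_normalizer_generateI)
qed

text \<open>If \<open>f\<close> conjugates \<sigma> to the \<open>j\<close>-th power of \<sigma>,
  each unit step of the argument adds \<open>j\<close> to the value, so \<open>f\<close> is affine
  with slope \<open>j\<close>.\<close>

lemma Hol_affine:
  assumes "f \<in> Hol k G"
  obtains a b where "represents k (\<lambda>x. a * x + b) f"
proof -
  have f: "f \<in> carrier (sym_group k)" "B.conj_set f G = G"
    using assms B.mem_normalizer_iff[OF cyclic_subset_carrier] by (auto simp: Hol_def)
  have perm: "f permutes {1..k}" using f by (simp add: sym_group_carrier)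
  have "\<sigma> \<in> G" by (simp add: generate.incl)
  then have "f \<otimes>\<^bsub>sym_group k\<^esub> \<sigma> \<otimes>\<^bsub>sym_group k\<^esub> inv\<^bsub>sym_group k\<^esub> f \<in> G"
    using f(2) B.conj_set_eq_image by blast
  then obtain j where "f \<circ> \<sigma> \<circ> Hilbert_Choice.inv f = \<sigma> ^^ j"
    using f(1) unfolding cyclic_eq by (auto simp: sym_group_mult)
  then have step: "f (\<sigma> x) = (\<sigma> ^^ j) (f x)" for x
    using permutes_inverses[OF perm] by (metis comp_apply)
  \<comment> \<open>The induction starts at the point 1, whence the constant term
    \<open>f 1 - j\<close>. Below \<open>k\<close> no wrap-around occurs, so \<sigma> is the plain
    successor there.\<close>
  have "[int (f x) = int j * int x + (int (f 1) - int j)] (mod int k)" if "1 \<le> x" "x \<le> k" for x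
    using that
  proof (induction x rule: nat_induct_at_least)
    case (Suc x)
    have x: "x \<in> {1..k}" "Suc x \<in> {1..k}" using Suc by auto
    have "[int (\<sigma> x) = int (Suc x)] (mod int k)"
      using representsD[OF represents_full_cycle x(1)] by (simp add: add.commute)
    then have "\<sigma> x = Suc x"
      using cong_atLeastAtMost_eq represents_in[OF represents_full_cycle x(1)] x(2) by blast
    then have "[int (f (Suc x)) = int (f x) + int j] (mod int k)"
      using step[of x] representsD[OF represents_full_cycle_funpow[of j], of "f x"]
        permutes_in_image[OF perm] x(1) by simp
    also have "[int (f x) + int j = int j * int x + (int (f 1) - int j) + int j] (mod int k)"
      using Suc by (intro cong_add) auto
    finally show ?case by (simp add: algebra_simps)
  qed simp
  then have "represents k (\<lambda>x. int j * x + (int (f 1) - int j)) f"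
    using perm by (simp add: represents_def)
  then show thesis by (rule that)
qed

lemma regular_cyclic: "regular_subgroup k G"
  unfolding regular_subgroup_iff
proof (intro conjI ballI impI)
  show "subgroup G (sym_group k)" by (rule subgroup_cyclic)
next
  fix x y assume xy: "x \<in> {1..k}" "y \<in> {1..k}"
  \<comment> \<open>The required translation is by \<open>y - x\<close>; reduction modulo
    \<open>k\<close> makes it a natural exponent.\<close>
  let ?g = "\<sigma> ^^ nat ((int y - int x) mod int k)"
  have "[int (?g x) = int x + (int y - int x) mod int k] (mod int k)"
    using representsD[OF represents_full_cycle_funpow xy(1),
        of "nat ((int y - int x) mod int k)"] k by simp
  also have "[int x + (int y - int x) mod int k = int y] (mod int k)"
    by (simp add: cong_def mod_simps)
  finally have "?g x = y"
    using cong_atLeastAtMost_eq represents_in[OF represents_full_cycle_funpow] xy by blast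
  then show "\<exists>g\<in>G. g x = y" unfolding cyclic_eq by blast
next
  fix x g assume x: "x \<in> {1..k}" and g: "g \<in> G" "g x = x"
  then obtain j where j: "g = \<sigma> ^^ j" unfolding cyclic_eq by blast
  have "[int j = 0] (mod int k)"
    using representsD[OF represents_full_cycle_funpow x, of j] g(2) j
    by (simp add: cong_iff_dvd_diff dvd_minus_iff)
  then have "represents k (\<lambda>x. x) g"
    unfolding j by (intro represents_cong[OF represents_full_cycle_funpow])
       (simp add: cong_iff_dvd_diff)
  then show "g = id" using represents_unique represents_id by blast
qed

text \<open>Commutativity is what the isomorphism with \<open>G\<close> contributes to the
  classification of the groups \<open>N\<close> below.\<close>

lemma cyclic_iso_commute:
  assumes "sym_group k\<lparr>carrier := N\<rparr> \<cong> sym_group k\<lparr>carrier := G\<rparr>"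
    and N: "subgroup N (sym_group k)" and "g \<in> N" "h \<in> N"
  shows "g \<circ> h = h \<circ> g"
proof -
  obtain \<phi> where \<phi>: "\<phi> \<in> iso (sym_group k\<lparr>carrier := N\<rparr>) (sym_group k\<lparr>carrier := G\<rparr>)"
    using assms(1) unfolding is_iso_def by blast
  have closed: "g \<circ> h \<in> N" "h \<circ> g \<in> N"
    using subgroup.m_closed[OF N] assms(3,4) by (simp_all add: sym_group_mult)
  have mult: "\<phi> (x \<circ> y) = \<phi> x \<circ> \<phi> y" if "x \<in> N" "y \<in> N" for x y
    using \<phi> that by (auto simp: iso_def hom_def sym_group_mult)
  have "\<phi> g \<in> G" "\<phi> h \<in> G" using \<phi> assms(3,4) by (auto simp: iso_def hom_def)
  then have "\<phi> g \<circ> \<phi> h = \<phi> h \<circ> \<phi> g"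
    unfolding cyclic_eq by (auto simp flip: funpow_add simp: add.commute)
  then have "\<phi> (g \<circ> h) = \<phi> (h \<circ> g)" using mult assms(3,4) by simp
  then show ?thesis using \<phi> closed by (auto simp: iso_def bij_betw_def dest: inj_onD)
qed

end

subsection \<open>The quasi-holomorph\<close>

text \<open>The arithmetic extracted from prime powers, with \<open>q = p ^ (n - m)\<close> and
  \<open>r = p ^ m\<close>. \<open>dvd_half\<close> makes \<open>q\<close> times the binomial
  coefficient well defined modulo \<open>k\<close>, \<open>r_dvd_q\<close> makes
  \<open>q * q\<close> vanish modulo \<open>k\<close>, and \<open>dvd_sqrt\<close> bounds the
  possible slopes.\<close>

locale quasi_holomorph = cyclic_sym_group +
  fixes q r :: nat and \<beta> :: "nat \<Rightarrow> nat"
  assumes k_eq: "k = q * r" and r_dvd_q: "r dvd q"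
    and dvd_half: "\<And>z. int q dvd 2 * z \<Longrightarrow> int r dvd z"
    and dvd_sqrt: "\<And>a. int k dvd a\<^sup>2 \<Longrightarrow> int q dvd a"
    and represents_beta: "represents k (\<lambda>x. x + int q * (x * (x - 1) div 2)) \<beta>"
begin

interpretation B: group "sym_group k" by (rule sym_group_is_group)

abbreviation (input) "P \<equiv> generate (sym_group k) {\<beta>}"

lemma binomial2_cong:
  "[x = y] (mod int q) \<Longrightarrow> [int q * (x * (x - 1) div 2) = int q * (y * (y - 1) div 2)] (mod int k)"
  unfolding k_eq of_nat_mult by (rule cong_mult_binomial2[OF dvd_half])

lemma k_dvd_q_square: "int k dvd int q * int q"
  using r_dvd_q by (simp add: k_eq flip: of_nat_mult)

lemma beta_carrier: "\<beta> \<in> carrier (sym_group k)"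
  using represents_beta by (rule represents_carrier)

lemma subgroup_P: "subgroup P (sym_group k)"
  using beta_carrier B.generate_is_subgroup by simp

lemma P_eq: "P = range (\<lambda>e. \<beta> ^^ e)"
  using beta_carrier by (rule generate_sym_group_singleton)

lemma P_carrier: "b \<in> P \<Longrightarrow> b \<in> carrier (sym_group k)"
  using subgroup_P by (rule subgroup.mem_carrier)

lemma beta_fun_cong:
  "[x = y] (mod int k) \<Longrightarrow>
     [x + int e * (int q * (x * (x - 1) div 2)) = y + int e * (int q * (y * (y - 1) div 2))] (mod int k)"
  using cong_dvd_modulus[of x y "int k" "int q"] k_eq
  by (intro cong_add cong_mult cong_refl binomial2_cong) auto

text \<open>\<beta> moves points by multiples of \<open>q\<close>, and such shifts do not change its
  displacement modulo \<open>k\<close>; hence displacements simply add up.\<close>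

lemma represents_beta_funpow:
  "represents k (\<lambda>x. x + int e * (int q * (x * (x - 1) div 2))) (\<beta> ^^ e)"
proof (induction e)
  case 0
  show ?case using represents_id[of k] by (simp add: id_def)
next
  case (Suc e)
  let ?F = "\<lambda>x. x + int e * (int q * (x * (x - 1) div 2))"
  have "represents k (\<lambda>x. ?F x + int q * (?F x * (?F x - 1) div 2)) (\<beta> \<circ> \<beta> ^^ e)"
    using beta_fun_cong[of _ _ 1] by (intro represents_comp[OF represents_beta Suc.IH]) simp
  moreover have "[?F x + int q * (?F x * (?F x - 1) div 2)
      = ?F x + int q * (x * (x - 1) div 2)] (mod int k)" for x
    by (intro cong_add cong_refl binomial2_cong) (simp add: cong_iff_dvd_diff)
  ultimately have "represents k (\<lambda>x. ?F x + int q * (x * (x - 1) div 2)) (\<beta> \<circ> \<beta> ^^ e)"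
    by (rule represents_cong)
  then show ?case by (simp add: algebra_simps o_def)
qed

text \<open>Passing from \<open>x\<close> to \<open>x + 1\<close> raises the binomial coefficient by
  \<open>x\<close>, which produces the slope \<open>1 + e * q\<close>. The remaining error is a
  multiple of \<open>q * q\<close>, hence of \<open>k\<close>.\<close>

lemma represents_beta_conj:
  "represents k (\<lambda>x. (1 + int e * int q) * x + 1)
     ((\<beta> ^^ e) \<otimes>\<^bsub>sym_group k\<^esub> full_cycle k \<otimes>\<^bsub>sym_group k\<^esub> inv\<^bsub>sym_group k\<^esub> (\<beta> ^^ e))"
proof (rule represents_conj[OF represents_beta_funpow represents_full_cycle beta_fun_cong])
  fix x :: int
  have "(x + 1) * x = x * (x - 1) + 2 * x" by (simp add: algebra_simps)
  then have "(x + 1) * (x + 1 - 1) div 2 = x * (x - 1) div 2 + x" by simp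
  then have "(1 + int e * int q) * (x + int e * (int q * (x * (x - 1) div 2))) + 1
      - (x + 1 + int e * (int q * ((x + 1) * (x + 1 - 1) div 2)))
      = int q * int q * (int e * int e * (x * (x - 1) div 2))"
    by (simp add: algebra_simps)
  then show "[x + 1 + int e * (int q * ((x + 1) * (x + 1 - 1) div 2))
      = (1 + int e * int q) * (x + int e * (int q * (x * (x - 1) div 2))) + 1] (mod int k)"
    using k_dvd_q_square by (metis cong_iff_dvd_diff cong_sym dvd_mult2)
qed (auto intro!: cong_add cong_mult)

lemma subgroup_Hol: "subgroup (Hol k G) (sym_group k)"
  unfolding Hol_def by (rule B.normalizer_imp_subgroup[OF cyclic_subset_carrier])

lemma conj_cyclic_subset_Hol:
  assumes "b \<in> P"
  shows "B.conj_set b G \<subseteq> Hol k G"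
proof -
  obtain e where "b = \<beta> ^^ e" using assms P_eq by blast
  then show ?thesis
    using B.conj_set_generate_subset subgroup_Hol full_cycle_carrier P_carrier assms
      affine_mem_Hol[OF represents_beta_conj] by blast
qed

text \<open>Affine maps have vanishing second difference, while that of the \<open>e\<close>-th
  power of \<beta> is \<open>e * q\<close>. If \<open>k\<close> divides \<open>e * q\<close>, this
  power is the identity.\<close>

lemma P_Int_Hol: "P \<inter> Hol k G = {\<one>\<^bsub>sym_group k\<^esub>}"
proof
  show "P \<inter> Hol k G \<subseteq> {\<one>\<^bsub>sym_group k\<^esub>}"
  proof
    fix b assume "b \<in> P \<inter> Hol k G"
    then obtain e a c where e: "b = \<beta> ^^ e" and ac: "represents k (\<lambda>x. a * x + c) b"
      using P_eq Hol_affine by blast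
    let ?F = "\<lambda>x. x + int e * (int q * (x * (x - 1) div 2))"
    \<comment> \<open>The congruence is known at the points of \<open>{1..k}\<close>; it is extended
      to all integers so that it can be evaluated at 0, 1 and 2.\<close>
    have F: "[?F x = a * x + c] (mod int k)" for x
    proof -
      define y where "y = (if x mod int k = 0 then k else nat (x mod int k))"
      have y: "y \<in> {1..k}"
        using k pos_mod_bound[of "int k" x] pos_mod_sign[of "int k" x]
        by (auto simp: y_def simp del: pos_mod_bound pos_mod_sign)
      have xy: "[x = int y] (mod int k)" using k by (simp add: y_def cong_def)
      have "[?F x = ?F (int y)] (mod int k)" using xy by (rule beta_fun_cong)
      also have "[?F (int y) = int (b y)] (mod int k)"
        using representsD[OF represents_beta_funpow y] e by (simp add: cong_sym)
      also have "[int (b y) = a * int y + c] (mod int k)" using representsD[OF ac y] .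
      also have "[a * int y + c = a * x + c] (mod int k)"
        using xy by (intro cong_add cong_mult cong_refl cong_sym[OF xy])
      finally show ?thesis .
    qed
    have "[(?F 2 - ?F 1) - (?F 1 - ?F 0) = ((a * 2 + c) - (a * 1 + c)) - ((a * 1 + c) - (a * 0 + c))]
        (mod int k)"
      by (intro cong_diff F)
    then have eq: "int k dvd int e * int q" by (simp add: cong_iff_dvd_diff)
    have "represents k (\<lambda>x. x) b"
      unfolding e
    proof (rule represents_cong[OF represents_beta_funpow])
      fix x
      show "[?F (int x) = int x] (mod int k)"
        using eq dvd_mult2[OF eq, of "int x * (int x - 1) div 2"]
        by (simp add: cong_iff_dvd_diff mult.assoc)
    qed
    then show "b \<in> {\<one>\<^bsub>sym_group k\<^esub>}"
      using represents_unique represents_id by (auto simp: sym_group_one)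
  qed
  show "{\<one>\<^bsub>sym_group k\<^esub>} \<subseteq> P \<inter> Hol k G"
    using subgroup.one_closed[OF subgroup_P] subgroup.one_closed[OF subgroup_Hol] by blast
qed

text \<open>Conjugation by the inverse of \<open>c\<close> reduces the claim to normalizing
  \<open>G\<close> itself, with the quotient \<open>?d\<close> in \<open>P\<close> in place of
  \<open>b\<close>.\<close>

lemma conj_cyclic_subset_normalizer:
  assumes "b \<in> P" "c \<in> P"
  shows "B.conj_set b G \<subseteq> normalizer (sym_group k) (B.conj_set c G)"
proof -
  let ?d = "inv\<^bsub>sym_group k\<^esub> c \<otimes>\<^bsub>sym_group k\<^esub> b"
  have d: "?d \<in> P" using assms subgroup_P
    by (simp add: subgroup.m_closed subgroup.m_inv_closed del: sym_group_inv_equality)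
  have carr: "b \<in> carrier (sym_group k)" "c \<in> carrier (sym_group k)"
      "?d \<in> carrier (sym_group k)" using assms d P_carrier by blast+
  have "B.conj_set c (B.conj_set ?d G) \<subseteq> normalizer (sym_group k) (B.conj_set c G)"
    using conj_cyclic_subset_Hol[OF d] carr cyclic_subset_carrier
    by (intro B.conj_set_normalizer_mono B.conj_set_subset_carrier) (auto simp: Hol_def)
  moreover have "B.conj_set c (B.conj_set ?d G) = B.conj_set (c \<otimes>\<^bsub>sym_group k\<^esub> ?d) G"
    using B.conj_set_mult carr cyclic_subset_carrier by metis
  moreover have "c \<otimes>\<^bsub>sym_group k\<^esub> ?d = b"
    using carr(1,2) by (simp add: B.m_assoc[symmetric] del: sym_group_inv_equality)
  ultimately show ?thesis by simp
qed

section \<open>Determination of S(G) \<inter> R(G) and Q(G)\<close>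

lemma cyclic_conj_one: "G = B.conj_set \<one>\<^bsub>sym_group k\<^esub> G"
  unfolding B.inv_one by (rule B.conj_set_one[OF cyclic_subset_carrier, symmetric])

lemma conj_iso_cyclic:
  assumes "b \<in> carrier (sym_group k)" "subgroup N (sym_group k)"
    "sym_group k\<lparr>carrier := N\<rparr> \<cong> sym_group k\<lparr>carrier := G\<rparr>"
  shows "sym_group k\<lparr>carrier := B.conj_set b N\<rparr> \<cong> sym_group k\<lparr>carrier := G\<rparr>"
  by (rule iso_trans[OF B.conj_set_iso[OF assms(1) subgroup.subset[OF assms(2)]
      B.subgroup_imp_group[OF assms(2)]] assms(3)])

lemma conj_cyclic_mem_S_R:
  assumes "b \<in> P"
  shows "B.conj_set b G \<in> S_set k G \<inter> R_set k G"
proof -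
  have "sym_group k\<lparr>carrier := B.conj_set b G\<rparr> \<cong> sym_group k\<lparr>carrier := G\<rparr>"
    using conj_iso_cyclic P_carrier[OF assms] subgroup_cyclic iso_refl by blast
  moreover have "regular_subgroup k (B.conj_set b G)"
    by (rule regular_subgroup_conj[OF P_carrier[OF assms] regular_cyclic])
  moreover have "G \<subseteq> normalizer (sym_group k) (B.conj_set b G)"
    using conj_cyclic_subset_normalizer[of "\<one>\<^bsub>sym_group k\<^esub>" b] subgroup_P assms cyclic_conj_one
    by (simp add: subgroup.one_closed)
  ultimately show ?thesis
    using conj_cyclic_subset_Hol[OF assms] by (simp add: S_set_def R_set_def)
qed

lemma S_R_conj_cyclic:
  assumes "N \<in> S_set k G \<inter> R_set k G"
  obtains b where "b \<in> P" "N = B.conj_set b G"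
proof -
  let ?\<sigma> = "full_cycle k"
  have reg: "regular_subgroup k N"
    and iso: "sym_group k\<lparr>carrier := N\<rparr> \<cong> sym_group k\<lparr>carrier := G\<rparr>"
    and NH: "N \<subseteq> Hol k G" and GN: "G \<subseteq> normalizer (sym_group k) N"
    using assms by (auto simp: S_set_def R_set_def)
  have sub: "subgroup N (sym_group k)" using reg by (simp add: regular_subgroup_iff)
  have kk: "k \<in> {1..k}" "1 \<in> {1..k}" using k by auto
  \<comment> \<open>The point \<open>k\<close> is the residue 0, so once \<tau> is known to be
    affine this choice makes its constant term 1.\<close>
  then obtain \<tau> where \<tau>: "\<tau> \<in> N" "\<tau> k = 1"
    using reg unfolding regular_subgroup_iff by blast
  obtain a c where ac: "represents k (\<lambda>x. a * x + c) \<tau>"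
    using \<tau>(1) NH Hol_affine by blast
  have "int k dvd 1 - (a * int k + c)"
    using representsD[OF ac, of k] k \<tau>(2) by (simp add: cong_iff_dvd_diff)
  then have "int k dvd 1 - (a * int k + c) + a * int k" by (rule dvd_add) simp
  then have "[1 = c] (mod int k)" by (simp add: cong_iff_dvd_diff)
  then have "[c = 1] (mod int k)" by (rule cong_sym)
  then have \<tau>_rep: "represents k (\<lambda>x. a * x + 1) \<tau>"
    by (intro represents_cong[OF ac]) (auto intro: cong_add)
  \<comment> \<open>The conjugate by the translation sends \<open>x\<close> to
    \<open>a * (x - 1) + 1 + 1\<close>, and it stays in \<open>N\<close> because \<open>G\<close>
    normalizes \<open>N\<close>.\<close>
  let ?\<nu> = "?\<sigma> \<otimes>\<^bsub>sym_group k\<^esub> \<tau> \<otimes>\<^bsub>sym_group k\<^esub> inv\<^bsub>sym_group k\<^esub> ?\<sigma>"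
  have \<nu>_rep: "represents k (\<lambda>x. a * x + (2 - a)) ?\<nu>"
    by (rule represents_conj[OF represents_full_cycle \<tau>_rep])
       (auto simp: algebra_simps intro!: cong_add cong_diff cong_mult)
  have "?\<sigma> \<in> G" by (simp add: generate.incl)
  then have "B.conj_set ?\<sigma> N = N"
    using GN B.mem_normalizer_iff[OF subgroup.subset[OF sub]] by blast
  then have "?\<nu> \<in> N" using \<tau>(1) B.conj_set_eq_image[of ?\<sigma> N] by blast
  then have comm: "?\<nu> \<circ> \<tau> = \<tau> \<circ> ?\<nu>"
    using cyclic_iso_commute[OF iso sub] \<tau>(1) by blast
  have rep1: "represents k (\<lambda>x. a * (a * x + 1) + (2 - a)) (?\<nu> \<circ> \<tau>)"
    by (rule represents_comp[OF \<nu>_rep \<tau>_rep]) (intro cong_add cong_mult cong_refl)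
  have rep2: "represents k (\<lambda>x. a * (a * x + (2 - a)) + 1) (?\<nu> \<circ> \<tau>)"
    unfolding comm by (rule represents_comp[OF \<tau>_rep \<nu>_rep]) (intro cong_add cong_mult cong_refl)
  \<comment> \<open>Evaluated at the residue 0, the two compositions give 2 and
    \<open>a * (2 - a) + 1\<close>, which differ by the square of \<open>a - 1\<close>.\<close>
  have "[a * (a * int k + 1) + (2 - a) = a * (a * int k + (2 - a)) + 1] (mod int k)"
    by (rule cong_trans[OF cong_sym[OF representsD[OF rep1 kk(1)]] representsD[OF rep2 kk(1)]])
  then have "int k dvd (a - 1)\<^sup>2"
    by (simp add: cong_iff_dvd_diff power2_eq_square algebra_simps)
  then obtain d where d: "a - 1 = int q * d" using dvd_sqrt by (metis dvd_def)
  have rpos: "r > 0" using k k_eq by simp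
  \<comment> \<open>As \<open>k = q * r\<close>, only the residue of \<open>d\<close> modulo
    \<open>r\<close> affects the slope \<open>1 + q * d\<close>; its least nonnegative
    representative serves as exponent.\<close>
  define e where "e = nat (d mod int r)"
  let ?b = "\<beta> ^^ e"
  have b: "?b \<in> P" using P_eq by blast
  have "int r dvd d - int e" using rpos by (simp add: e_def)
  then have "int k dvd int q * (d - int e)" by (simp add: k_eq)
  then have k_dvd: "int k dvd a - (1 + int e * int q)" using d by (simp add: algebra_simps)
  have "represents k (\<lambda>x. (1 + int e * int q) * x + 1) \<tau>"
    using k_dvd by (intro represents_cong[OF \<tau>_rep] cong_add cong_mult cong_refl)
      (simp add: cong_iff_dvd_diff)
  then have "?b \<otimes>\<^bsub>sym_group k\<^esub> ?\<sigma> \<otimes>\<^bsub>sym_group k\<^esub> inv\<^bsub>sym_group k\<^esub> ?b = \<tau>"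
    using represents_unique represents_beta_conj by blast
  then have "B.conj_set ?b G \<subseteq> N"
    using B.conj_set_generate_subset[OF P_carrier[OF b] full_cycle_carrier sub] \<tau>(1) by simp
  \<comment> \<open>Both groups are regular, so the inclusion is an equality.\<close>
  then have "N = B.conj_set ?b G"
    using regular_subgroup_eqI[OF regular_subgroup_conj[OF P_carrier[OF b] regular_cyclic] reg _ k]
    by simp
  with b show thesis by (rule that)
qed

lemma S_R_eq: "S_set k G \<inter> R_set k G = (\<lambda>b. B.conj_set b G) ` P"
  using S_R_conj_cyclic conj_cyclic_mem_S_R by blast

lemma Q_set_eq: "Q_set k G = (\<lambda>b. B.conj_set b G) ` P"
proof -
  \<comment> \<open>The family being intersected is therefore nonempty, and each of its members is
    the whole orbit by mutual normalization.\<close>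
  have "\<one>\<^bsub>sym_group k\<^esub> \<in> P" using subgroup_P by (rule subgroup.one_closed)
  then show ?thesis
    unfolding Q_set_def S_R_eq using conj_cyclic_subset_normalizer by blast
qed

text \<open>Regularity, the isomorphism type and mutual normalization with \<open>G\<close> all
  survive conjugation by an element that normalizes \<open>G\<close>. The image thus lies in S(G)
  \<inter> R(G), which is the orbit.\<close>

lemma Hol_conj_stable:
  assumes h: "h \<in> Hol k G" and c: "c \<in> P"
  shows "B.conj_set h (B.conj_set c G) \<in> (\<lambda>b. B.conj_set b G) ` P"
proof -
  have hc: "h \<in> carrier (sym_group k)" and hG: "B.conj_set h G = G"
    using h B.mem_normalizer_iff[OF cyclic_subset_carrier] by (auto simp: Hol_def)
  let ?M = "B.conj_set c G"
  have M: "regular_subgroup k ?M" "sym_group k\<lparr>carrier := ?M\<rparr> \<cong> sym_group k\<lparr>carrier := G\<rparr>"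
    "?M \<subseteq> normalizer (sym_group k) G" "G \<subseteq> normalizer (sym_group k) ?M"
    using conj_cyclic_mem_S_R[OF c] by (auto simp: S_set_def R_set_def Hol_def)
  have sub: "subgroup ?M (sym_group k)" using M by (simp add: regular_subgroup_iff)
  have "B.conj_set h ?M \<subseteq> normalizer (sym_group k) G"
    using B.conj_set_normalizer_mono[OF hc subgroup.subset[OF sub] cyclic_subset_carrier M(3)] hG
    by simp
  moreover have "G \<subseteq> normalizer (sym_group k) (B.conj_set h ?M)"
    using B.conj_set_normalizer_mono[OF hc cyclic_subset_carrier subgroup.subset[OF sub] M(4)] hG
    by simp
  moreover note regular_subgroup_conj[OF hc M(1)] conj_iso_cyclic[OF hc sub M(2)]
  ultimately have "B.conj_set h ?M \<in> S_set k G \<inter> R_set k G"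
    by (simp add: S_set_def R_set_def Hol_def)
  then show ?thesis by (simp only: S_R_eq)
qed

lemma QHol_zappa_szep:
  "is_pi_Q k G P" "zappa_szep_product (sym_group k) (QHol k G) P (Hol k G)"
proof -
  note * = B.subgroup_transversal_mult_normalizer[OF subgroup_P cyclic_subset_carrier
      P_Int_Hol[unfolded Hol_def] Hol_conj_stable[unfolded Hol_def]]
  show pi: "is_pi_Q k G P"
    using *(1) P_carrier unfolding is_pi_Q_def Setcompr_eq_image Q_set_eq Hol_def by blast
  \<comment> \<open>Independence of the chosen representatives allows \<open>P\<close> to replace
    the arbitrary choice in \<open>QHol\<close>.\<close>
  have "QHol k G = P <#>\<^bsub>sym_group k\<^esub> Hol k G"
    unfolding QHol_eq[OF cyclic_subset_carrier pi] by (auto simp: set_mult_def l_coset_def)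
  then show "zappa_szep_product (sym_group k) (QHol k G) P (Hol k G)"
    using *(2) subgroup_P subgroup_Hol P_Int_Hol by (simp add: zappa_szep_product_def Hol_def)
qed

end

section \<open>Prime power arithmetic and the quasi-holomorph for \<open>k = p ^ n\<close>\<close>

lemma prime_power_dvd_square:
  fixes a :: int
  assumes "prime p" "int (p ^ n) dvd a\<^sup>2"
  shows "int (p ^ (n - n div 2)) dvd a"
proof (cases "a = 0")
  case False
  have p: "prime (int p)" using assms(1) by simp
  \<comment> \<open>Squaring doubles the multiplicity of \<open>p\<close>, so that of
    \<open>a\<close> is at least \<open>n / 2\<close> rounded up, which is
    \<open>n - n div 2\<close>.\<close>
  have "n \<le> multiplicity (int p) (a\<^sup>2)"
    using assms p False by (intro multiplicity_geI) auto
  also have "\<dots> = 2 * multiplicity (int p) a"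
    using p False by (simp add: prime_elem_multiplicity_power_distrib)
  finally have "n - n div 2 \<le> multiplicity (int p) a" by linarith
  then show ?thesis by (simp add: multiplicity_dvd')
qed simp

theorem corollary5p11:
  fixes p n m :: nat and G :: "(nat \<Rightarrow> nat) set"
  assumes "m = n div 2"
    and "(p = 2 \<and> n = 2 * m + 1 \<and> m \<ge> 1) \<or> (prime p \<and> p > 2 \<and> n \<ge> 1)"
    and "G = generate (sym_group (p ^ n)) {full_cycle (p ^ n)}"
  shows "subgroup (QHol (p ^ n) G) (sym_group (p ^ n)) \<and>
         is_pi_Q (p ^ n) G (generate (sym_group (p ^ n)) {beta_perm p n m}) \<and>
         zappa_szep_product (sym_group (p ^ n)) (QHol (p ^ n) G)
           (generate (sym_group (p ^ n)) {beta_perm p n m}) (Hol (p ^ n) G)"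
proof -
  have p: "prime p" using assms(2) by auto
  have m: "m \<le> n" "m \<le> n - m" using assms(1) by auto
  have p1: "p > 1" using p prime_gt_1_nat by blast
  \<comment> \<open>For \<open>p = 2\<close> the exponent \<open>n\<close> is odd, so
    \<open>p ^ (n - m)\<close> has exactly one more factor 2 than \<open>p ^ m\<close> to give away;
    for odd \<open>p\<close> the factor 2 is coprime to \<open>p ^ m\<close>.\<close>
  have half: "int (p ^ m) dvd z" if "int (p ^ (n - m)) dvd 2 * z" for z
  proof (cases "p = 2")
    case True
    then have "n - m = Suc m" using assms(2) by auto
    then show ?thesis using that True by simp
  next
    case False
    then have "odd p" using p prime_odd_nat p1 by (metis nat_neq_iff not_less_eq One_nat_def Suc_1)
    then have "coprime (int (p ^ m)) 2" by simp
    moreover have "int (p ^ m) dvd 2 * z"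
      using that m by (meson dvd_trans le_imp_power_dvd of_nat_dvd_iff)
    ultimately show ?thesis by (simp add: coprime_dvd_mult_right_iff)
  qed
  interpret quasi_holomorph "p ^ n" "p ^ (n - m)" "p ^ m" "beta_perm p n m"
  proof
    show "p ^ n = p ^ (n - m) * p ^ m" using m by (simp flip: power_add)
    show "p ^ m dvd p ^ (n - m)" using m by (simp add: le_imp_power_dvd)
    show "int (p ^ (n - m)) dvd a" if "int (p ^ n) dvd a\<^sup>2" for a
      using prime_power_dvd_square[OF p that] assms(1) by simp
    show "represents (p ^ n) (\<lambda>x. x + int (p ^ (n - m)) * (x * (x - 1) div 2)) (beta_perm p n m)"
      using represents_beta_perm m half p1 by simp
  qed (use p1 half in auto)
  show ?thesis
    using QHol_zappa_szep unfolding assms(3) zappa_szep_product_def by blast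
qed

end
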